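(* Let $G$ be a diffeological group. The actions of $G$ and of $\mathbb Z_2=\{\pm1\}$ on $E^{\mathrm{sph}}(G)$ given by $h\cdot[(x_i,g_i)]=[(x_i,hg_i)]$ and $\varepsilon\cdot[(x_i,g_i)]=[(\varepsilon x_i,g_i)]$ commute.
   Context: Let $\widetilde E^{\mathrm{sph}}(G)$ be the set of families $(x_i,g_i)_{i\in\mathbb N}$ with $x_i\in\mathbb R$, $g_i\in G$, only finitely many $x_i$ nonzero, and $\sum_i x_i^2=1$. Define $(x_i,g_i)\sim(x_i,g_i')$ iff $g_i=g_i'$ for every $i$ with $x_i\neq 0$ (the coordinates $x_i$ being the same), and $E^{\mathrm{sph}}(G)=\widetilde E^{\mathrm{sph}}(G)/\sim$; classes are written $[(x_i,g_i)]$. *)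

theory Defs
  imports
    "HOL-Analysis.Abstract_Euclidean_Space"
    "HOL-Analysis.Derivative"
    "HOL-Algebra.Group_Action"
    "HOL-Algebra.Sym_Groups"
begin

section \<open>Smooth maps between open subsets of Euclidean spaces of varying dimension\<close>

text \<open>
  A diffeology involves the spaces \<open>\<real>\<^sup>n\<close> for all \<open>n\<close> at once, so the dimension cannot be a type.
  We use \<^const>\<open>Euclidean_space\<close>, where \<open>\<real>\<^sup>n\<close> consists of the functions \<open>nat \<Rightarrow> real\<close> that
  vanish at all indices \<open>i \<ge> n\<close>.
\<close>

definition partial_deriv :: "nat \<Rightarrow> ((nat \<Rightarrow> real) \<Rightarrow> real) \<Rightarrow> (nat \<Rightarrow> real) \<Rightarrow> real"
  where "partial_deriv i f x = deriv (\<lambda>t. f (x(i := t))) (x i)"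

text \<open>\<open>Ck_on n k U f\<close>: on the open set \<open>U\<close> of \<open>\<real>\<^sup>n\<close>, all partial derivatives of \<open>f\<close> of order at
  most \<open>k\<close> exist and are continuous.\<close>

primrec Ck_on :: "nat \<Rightarrow> nat \<Rightarrow> (nat \<Rightarrow> real) set \<Rightarrow> ((nat \<Rightarrow> real) \<Rightarrow> real) \<Rightarrow> bool"
  where
    "Ck_on n 0 U f \<longleftrightarrow> continuous_map (subtopology (Euclidean_space n) U) euclideanreal f"
  | "Ck_on n (Suc k) U f \<longleftrightarrow>
       continuous_map (subtopology (Euclidean_space n) U) euclideanreal f \<and>
       (\<forall>i<n. (\<forall>x\<in>U. (\<lambda>t. f (x(i := t))) field_differentiable at (x i)) \<and>
              Ck_on n k U (partial_deriv i f))"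

definition euclidean_smooth ::
  "nat \<Rightarrow> (nat \<Rightarrow> real) set \<Rightarrow> nat \<Rightarrow> (nat \<Rightarrow> real) set \<Rightarrow> ((nat \<Rightarrow> real) \<Rightarrow> nat \<Rightarrow> real) \<Rightarrow> bool"
  where "euclidean_smooth m V n U F \<longleftrightarrow>
           F \<in> V \<rightarrow> U \<and> (\<forall>j<n. \<forall>k. Ck_on m k V (\<lambda>v. F v j))"


section \<open>Diffeological groups\<close>

text \<open>
  A triple \<open>(n, U, p)\<close> stands for a parametrization \<open>p : U \<rightarrow> X\<close> with \<open>U\<close> open in \<open>\<real>\<^sup>n\<close>. The
  function \<open>p\<close> is \<^const>\<open>undefined\<close> outside \<open>U\<close>, so that equality of triples is equality of
  parametrizations.
\<close>

type_synonym 'a parametrization = "nat \<times> (nat \<Rightarrow> real) set \<times> ((nat \<Rightarrow> real) \<Rightarrow> 'a)"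

definition parametrizations :: "'a set \<Rightarrow> 'a parametrization set"
  where "parametrizations X =
           {(n, U, p). openin (Euclidean_space n) U \<and> p \<in> U \<rightarrow>\<^sub>E X}"

locale diffeology =
  fixes X :: "'a set" and D :: "'a parametrization set"
  assumes plots_subset: "D \<subseteq> parametrizations X"
    and covering:
      "\<And>n U x. openin (Euclidean_space n) U \<Longrightarrow> x \<in> X \<Longrightarrow> (n, U, \<lambda>u\<in>U. x) \<in> D"
    and locality:
      "\<And>n U p. (n, U, p) \<in> parametrizations X \<Longrightarrow>
         (\<And>u. u \<in> U \<Longrightarrow> \<exists>V. openin (Euclidean_space n) V \<and> u \<in> V \<and> V \<subseteq> U \<and>
                              (n, V, restrict p V) \<in> D) \<Longrightarrow>
         (n, U, p) \<in> D"
    and smooth_compatibility: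
      "\<And>n U p m V F. (n, U, p) \<in> D \<Longrightarrow> openin (Euclidean_space m) V \<Longrightarrow>
         euclidean_smooth m V n U F \<Longrightarrow> (m, V, compose V p F) \<in> D"

definition diffeological_smooth ::
  "'a set \<Rightarrow> 'a parametrization set \<Rightarrow> 'b set \<Rightarrow> 'b parametrization set \<Rightarrow> ('a \<Rightarrow> 'b) \<Rightarrow> bool"
  where "diffeological_smooth X D Y D' f \<longleftrightarrow>
           f \<in> X \<rightarrow> Y \<and> (\<forall>n U p. (n, U, p) \<in> D \<longrightarrow> (n, U, compose U f p) \<in> D')"

definition product_diffeology ::
  "'a set \<Rightarrow> 'a parametrization set \<Rightarrow> 'b set \<Rightarrow> 'b parametrization set \<Rightarrow> ('a \<times> 'b) parametrization set"
  where "product_diffeology X D Y D' =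
           {(n, U, p) \<in> parametrizations (X \<times> Y).
              (n, U, compose U fst p) \<in> D \<and> (n, U, compose U snd p) \<in> D'}"

locale diffeological_group = group G + diffeology "carrier G" D
  for G :: "('a, 'b) monoid_scheme" (structure) and D :: "'a parametrization set" +
  assumes mult_smooth:
      "diffeological_smooth (carrier G \<times> carrier G)
         (product_diffeology (carrier G) D (carrier G) D) (carrier G) D (\<lambda>(g, h). g \<otimes> h)"
    and inv_smooth:
      "diffeological_smooth (carrier G) D (carrier G) D (\<lambda>g. inv g)"


section \<open>The spherical total space and the two actions\<close>

definition Esph_tilde :: "('a, 'b) monoid_scheme \<Rightarrow> (nat \<Rightarrow> real \<times> 'a) set"
  where "Esph_tilde G =
           {\<xi>. (\<forall>i. snd (\<xi> i) \<in> carrier G) \<and> finite {i. fst (\<xi> i) \<noteq> 0} \<and>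
               (\<Sum>i | fst (\<xi> i) \<noteq> 0. (fst (\<xi> i))\<^sup>2) = 1}"

definition Esph_rel ::
  "('a, 'b) monoid_scheme \<Rightarrow> ((nat \<Rightarrow> real \<times> 'a) \<times> (nat \<Rightarrow> real \<times> 'a)) set"
  where "Esph_rel G =
           {(\<xi>, \<eta>). \<xi> \<in> Esph_tilde G \<and> \<eta> \<in> Esph_tilde G \<and> (\<forall>i. fst (\<xi> i) = fst (\<eta> i)) \<and>
                     (\<forall>i. fst (\<xi> i) \<noteq> 0 \<longrightarrow> snd (\<xi> i) = snd (\<eta> i))}"

definition Esph :: "('a, 'b) monoid_scheme \<Rightarrow> (nat \<Rightarrow> real \<times> 'a) set set"
  where "Esph G = Esph_tilde G // Esph_rel G"

definition Esph_class ::
  "('a, 'b) monoid_scheme \<Rightarrow> (nat \<Rightarrow> real \<times> 'a) \<Rightarrow> (nat \<Rightarrow> real \<times> 'a) set"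
  where "Esph_class G \<xi> = Esph_rel G `` {\<xi>}"

text \<open>
  Both maps are the lifts to the quotient of the operation on representatives: the union runs over
  the classes obtained from all representatives, so it is the common value of those classes if the
  formula is well defined. The maps are restricted to \<^const>\<open>Esph\<close> because \<^const>\<open>Bij\<close>, hence
  \<^const>\<open>group_action\<close>, requires extensional functions.
\<close>

definition Esph_left_action ::
  "('a, 'b) monoid_scheme \<Rightarrow> 'a \<Rightarrow> (nat \<Rightarrow> real \<times> 'a) set \<Rightarrow> (nat \<Rightarrow> real \<times> 'a) set"
  where "Esph_left_action G h =
           (\<lambda>C\<in>Esph G. \<Union>\<xi>\<in>C. Esph_class G (\<lambda>i. (fst (\<xi> i), h \<otimes>\<^bsub>G\<^esub> snd (\<xi> i))))"

text \<open>The group \<open>\<int>\<^sub>2 = {\<plusminus>1}\<close> is \<^const>\<open>sign_img\<close>, with elements of type \<^typ>\<open>int\<close>.\<close>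

definition Esph_sign_action ::
  "('a, 'b) monoid_scheme \<Rightarrow> int \<Rightarrow> (nat \<Rightarrow> real \<times> 'a) set \<Rightarrow> (nat \<Rightarrow> real \<times> 'a) set"
  where "Esph_sign_action G \<epsilon> =
           (\<lambda>C\<in>Esph G. \<Union>\<xi>\<in>C. Esph_class G (\<lambda>i. (real_of_int \<epsilon> * fst (\<xi> i), snd (\<xi> i))))"

end

theory Submission
  imports Defs
begin

text \<open>
  The two operations on representatives touch different coordinates: \<open>h\<close> multiplies the group
  entries \<open>g\<^sub>i\<close> and \<open>\<epsilon>\<close> rescales the real entries \<open>x\<^sub>i\<close>. They therefore commute on the nose, and
  each is an action because the group laws hold entry by entry. What has to be checked is that this
  survives the passage to the quotient.

  Since \<open>\<epsilon> = \<plusminus>1\<close>, the sign changes neither the support \<open>{i. x\<^sub>i \<noteq> 0}\<close> nor the squares \<open>x\<^sub>i\<^sup>2\<close>;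
  left multiplication does not change the \<open>x\<^sub>i\<close> at all. So both operations preserve
  \<^const>\<open>Esph_tilde\<close> and respect \<^const>\<open>Esph_rel\<close>, which compares all the \<open>x\<^sub>i\<close>,
  but the \<open>g\<^sub>i\<close> only over the support. An action on a set that respects an equivalence relation induces an action on the
  quotient (\<open>group_action_quotient\<close>), and the induced maps are computed on any representative
  (\<open>Esph_left_action_class\<close>, \<open>Esph_sign_action_class\<close>). These formulas reduce commutation on
  \<^const>\<open>Esph\<close> to commutation of representatives.
\<close>

text \<open>
  Bijectivity of the maps comes for free: the map of \<open>inv g\<close> is a two-sided inverse of that of \<open>g\<close>.
\<close>

lemma (in group) group_actionI:
  assumes ext: "\<And>g. g \<in> carrier G \<Longrightarrow> \<phi> g \<in> extensional E"
    and closed: "\<And>g x. g \<in> carrier G \<Longrightarrow> x \<in> E \<Longrightarrow> \<phi> g x \<in> E"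
    and one: "\<And>x. x \<in> E \<Longrightarrow> \<phi> \<one> x = x"
    and mult: "\<And>g h x. g \<in> carrier G \<Longrightarrow> h \<in> carrier G \<Longrightarrow> x \<in> E \<Longrightarrow> \<phi> (g \<otimes> h) x = \<phi> g (\<phi> h x)"
  shows "group_action G E \<phi>"
proof -
  have inv: "\<phi> (inv g) (\<phi> g x) = x" "\<phi> g (\<phi> (inv g) x) = x" if "g \<in> carrier G" "x \<in> E" for g x
    using that mult[of "inv g" g x] mult[of g "inv g" x] by (simp_all add: one)
  have Bij: "\<phi> g \<in> Bij E" if g: "g \<in> carrier G" for g
  proof -
    have "bij_betw (\<phi> g) E E"
      by (rule bij_betw_byWitness[where f' = "\<phi> (inv g)"]) (use g inv closed in auto)
    then show ?thesis
      using ext[OF g] by (simp add: Bij_def)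
  qed
  have "\<phi> (g \<otimes> h) = \<phi> g \<otimes>\<^bsub>BijGroup E\<^esub> \<phi> h" if "g \<in> carrier G" "h \<in> carrier G" for g h
  proof
    fix x
    show "\<phi> (g \<otimes> h) x = (\<phi> g \<otimes>\<^bsub>BijGroup E\<^esub> \<phi> h) x"
      using that Bij by (cases "x \<in> E")
        (simp_all add: BijGroup_def compose_def mult extensional_arb[OF ext])
  qed
  then have "\<phi> \<in> hom G (BijGroup E)"
    using Bij by (auto simp: hom_def BijGroup_def)
  then show ?thesis
    by (simp add: group_action_def group_hom_def group_hom_axioms_def group_BijGroup is_group)
qed

text \<open>
  The classes of \<open>f y\<close>, with \<open>y\<close> ranging over the class of \<open>x\<close>, all coincide, so their union is any
  one of them.
\<close>

lemma quotient_lift_class: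
  assumes "equiv A R"
    and "\<And>x y. (x, y) \<in> R \<Longrightarrow> (f x, f y) \<in> R"
    and "x \<in> A"
  shows "(\<lambda>C\<in>A // R. \<Union>y\<in>C. R `` {f y}) (R `` {x}) = R `` {f x}"
proof -
  have "(\<lambda>y. R `` {f y}) respects R"
    using assms by (auto intro!: congruentI equiv_class_eq)
  then show ?thesis
    using assms UN_equiv_class[of A R "\<lambda>y. R `` {f y}" x] by (simp add: quotientI)
qed

text \<open>
  The group laws for the induced maps are those for representatives, read off class by class.
  Invariance of \<open>R\<close> also shows that each \<open>act g\<close> maps \<open>A\<close> into itself: \<open>x \<in> A\<close> means
  \<open>(x, x) \<in> R\<close>, hence \<open>(act g x, act g x) \<in> R\<close>.
\<close>

lemma (in group) group_action_quotient:
  assumes R: "equiv A R"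
    and rel: "\<And>g x y. g \<in> carrier G \<Longrightarrow> (x, y) \<in> R \<Longrightarrow> (act g x, act g y) \<in> R"
    and one: "\<And>x. x \<in> A \<Longrightarrow> act \<one> x = x"
    and mult: "\<And>g h x. g \<in> carrier G \<Longrightarrow> h \<in> carrier G \<Longrightarrow> x \<in> A \<Longrightarrow>
                 act (g \<otimes> h) x = act g (act h x)"
  shows "group_action G (A // R) (\<lambda>g. \<lambda>C\<in>A // R. \<Union>x\<in>C. R `` {act g x})"
proof -
  have closed: "act g x \<in> A" if "g \<in> carrier G" "x \<in> A" for g x
    using that R rel[of g x x] by (auto simp: equiv_class_eq_iff)
  define \<phi> where "\<phi> g = (\<lambda>C\<in>A // R. \<Union>x\<in>C. R `` {act g x})" for g
  have on_class: "\<phi> g (R `` {x}) = R `` {act g x}" if "g \<in> carrier G" "x \<in> A" for g x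
    unfolding \<phi>_def using R rel[OF that(1)] that(2) by (rule quotient_lift_class)
  have "group_action G (A // R) \<phi>"
  proof (rule group_actionI)
    show "\<phi> g \<in> extensional (A // R)" for g
      by (simp add: \<phi>_def)
    show "\<phi> g C \<in> A // R" if "g \<in> carrier G" "C \<in> A // R" for g C
      using that(2) by (rule quotientE) (simp add: on_class closed quotientI that(1))
    show "\<phi> \<one> C = C" if "C \<in> A // R" for C
      using that by (rule quotientE) (simp add: on_class one)
    show "\<phi> (g \<otimes> h) C = \<phi> g (\<phi> h C)"
      if "g \<in> carrier G" "h \<in> carrier G" "C \<in> A // R" for g h C
      using that(3) by (rule quotientE) (simp add: on_class closed mult that(1,2))
  qed
  then show ?thesis
    by (simp add: \<phi>_def[abs_def])
qed

lemma equiv_Esph_rel: "equiv (Esph_tilde G) (Esph_rel G)"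
  by (rule equivI) (auto simp: Esph_rel_def refl_on_def sym_def trans_def)

lemma Esph_tilde_left_mult:
  assumes "group G" "h \<in> carrier G" "\<xi> \<in> Esph_tilde G"
  shows "(\<lambda>i. (fst (\<xi> i), h \<otimes>\<^bsub>G\<^esub> snd (\<xi> i))) \<in> Esph_tilde G"
  using assms by (auto simp: Esph_tilde_def group.is_monoid monoid.m_closed)

lemma Esph_rel_left_mult:
  assumes "group G" "h \<in> carrier G" "(\<xi>, \<eta>) \<in> Esph_rel G"
  shows "((\<lambda>i. (fst (\<xi> i), h \<otimes>\<^bsub>G\<^esub> snd (\<xi> i))), (\<lambda>i. (fst (\<eta> i), h \<otimes>\<^bsub>G\<^esub> snd (\<eta> i)))) \<in> Esph_rel G"
  using assms Esph_tilde_left_mult[OF assms(1,2), of \<xi>] Esph_tilde_left_mult[OF assms(1,2), of \<eta>]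
  by (auto simp: Esph_rel_def)

lemma carrier_sign_img: "\<epsilon> \<in> carrier sign_img \<longleftrightarrow> \<epsilon> = 1 \<or> \<epsilon> = -1"
  by (auto simp: sign_img_def)

lemma Esph_tilde_sign:
  assumes "\<epsilon> \<in> carrier sign_img" "\<xi> \<in> Esph_tilde G"
  shows "(\<lambda>i. (real_of_int \<epsilon> * fst (\<xi> i), snd (\<xi> i))) \<in> Esph_tilde G"
  using assms by (auto simp: Esph_tilde_def carrier_sign_img)

lemma Esph_rel_sign:
  assumes "\<epsilon> \<in> carrier sign_img" "(\<xi>, \<eta>) \<in> Esph_rel G"
  shows "((\<lambda>i. (real_of_int \<epsilon> * fst (\<xi> i), snd (\<xi> i))),
          (\<lambda>i. (real_of_int \<epsilon> * fst (\<eta> i), snd (\<eta> i)))) \<in> Esph_rel G"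
  using assms Esph_tilde_sign[OF assms(1), of \<xi>] Esph_tilde_sign[OF assms(1), of \<eta>]
  by (auto simp: Esph_rel_def)

lemma Esph_left_action_class:
  assumes "group G" "h \<in> carrier G" "\<xi> \<in> Esph_tilde G"
  shows "Esph_left_action G h (Esph_class G \<xi>) =
         Esph_class G (\<lambda>i. (fst (\<xi> i), h \<otimes>\<^bsub>G\<^esub> snd (\<xi> i)))"
  unfolding Esph_left_action_def Esph_class_def Esph_def
  using equiv_Esph_rel Esph_rel_left_mult[OF assms(1,2)] assms(3) by (rule quotient_lift_class)

lemma Esph_sign_action_class:
  assumes "\<epsilon> \<in> carrier sign_img" "\<xi> \<in> Esph_tilde G"
  shows "Esph_sign_action G \<epsilon> (Esph_class G \<xi>) =
         Esph_class G (\<lambda>i. (real_of_int \<epsilon> * fst (\<xi> i), snd (\<xi> i)))"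
  unfolding Esph_sign_action_def Esph_class_def Esph_def
  using equiv_Esph_rel Esph_rel_sign[OF assms(1)] assms(2) by (rule quotient_lift_class)

lemma group_action_Esph_left_action:
  assumes "group G"
  shows "group_action G (Esph G) (Esph_left_action G)"
proof -
  interpret group G by fact
  have "group_action G (Esph_tilde G // Esph_rel G)
          (\<lambda>h. \<lambda>C\<in>Esph_tilde G // Esph_rel G.
             \<Union>\<xi>\<in>C. Esph_rel G `` {\<lambda>i. (fst (\<xi> i), h \<otimes>\<^bsub>G\<^esub> snd (\<xi> i))})"
    by (rule group_action_quotient[OF equiv_Esph_rel])
       (auto intro: Esph_rel_left_mult[OF assms] simp: Esph_tilde_def m_assoc)
  then show ?thesis
    by (simp add: Esph_def Esph_class_def Esph_left_action_def[abs_def])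
qed

lemma group_action_Esph_sign_action: "group_action sign_img (Esph G) (Esph_sign_action G)"
proof -
  interpret group sign_img by (rule sign_img_is_group)
  have "group_action sign_img (Esph_tilde G // Esph_rel G)
          (\<lambda>\<epsilon>. \<lambda>C\<in>Esph_tilde G // Esph_rel G.
             \<Union>\<xi>\<in>C. Esph_rel G `` {\<lambda>i. (real_of_int \<epsilon> * fst (\<xi> i), snd (\<xi> i))})"
    by (rule group_action_quotient[OF equiv_Esph_rel])
       (auto intro: Esph_rel_sign simp: sign_img_def mult.assoc)
  then show ?thesis
    by (simp add: Esph_def Esph_class_def Esph_sign_action_def[abs_def])
qed

lemma Esph_left_action_sign_action_commute:
  assumes G: "group G" and h: "h \<in> carrier G" and \<epsilon>: "\<epsilon> \<in> carrier sign_img" and C: "C \<in> Esph G"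
  shows "Esph_left_action G h (Esph_sign_action G \<epsilon> C) =
         Esph_sign_action G \<epsilon> (Esph_left_action G h C)"
proof -
  obtain \<xi> where \<xi>: "\<xi> \<in> Esph_tilde G" and C_eq: "C = Esph_class G \<xi>"
    using C by (auto simp: Esph_def Esph_class_def elim: quotientE)
  (* Both sides are the class of the family (\<epsilon> x_i, h g_i). *)
  show ?thesis
    by (simp add: C_eq Esph_left_action_class[OF G h] Esph_sign_action_class[OF \<epsilon>] \<xi>
        Esph_tilde_left_mult[OF G h] Esph_tilde_sign[OF \<epsilon>])
qed

theorem proposition4p10:
  fixes G :: "('a, 'b) monoid_scheme" and D :: "'a parametrization set"
  assumes "diffeological_group G D"
  shows "group_action G (Esph G) (Esph_left_action G) \<and>
         group_action sign_img (Esph G) (Esph_sign_action G) \<and>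
         (\<forall>h\<in>carrier G. \<forall>\<xi>\<in>Esph_tilde G.
            Esph_left_action G h (Esph_class G \<xi>) =
              Esph_class G (\<lambda>i. (fst (\<xi> i), h \<otimes>\<^bsub>G\<^esub> snd (\<xi> i)))) \<and>
         (\<forall>\<epsilon>\<in>carrier sign_img. \<forall>\<xi>\<in>Esph_tilde G.
            Esph_sign_action G \<epsilon> (Esph_class G \<xi>) =
              Esph_class G (\<lambda>i. (real_of_int \<epsilon> * fst (\<xi> i), snd (\<xi> i)))) \<and>
         (\<forall>h\<in>carrier G. \<forall>\<epsilon>\<in>carrier sign_img. \<forall>C\<in>Esph G.
            Esph_left_action G h (Esph_sign_action G \<epsilon> C) =
              Esph_sign_action G \<epsilon> (Esph_left_action G h C))"
proof -
  have G: "group G"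
    using assms by (rule diffeological_group.axioms)
  show ?thesis
    using group_action_Esph_left_action[OF G] group_action_Esph_sign_action
      Esph_left_action_class[OF G] Esph_sign_action_class
      Esph_left_action_sign_action_commute[OF G]
    by blast
qed

end
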